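(* Let $(\mathcal{P},\eta,K)$ be a para-Kähler manifold, let $B:T_+\to T_-$ be a bundle map with $\eta(BX,Y)=-\eta(X,BY)$ for all $X,Y\in\Gamma(T_+)$, and let $K_B$ be the corresponding $B$-transformation of $K$, with associated two-form $b$. Let $[\![\ ,\ ]\!]^D$ denote the D-bracket of $(\eta,K)$ and $[\![\ ,\ ]\!]^{D,B}$ the D-bracket associated to $(\eta,K_B)$. Then for all vector fields $X,Y,Z$ on $\mathcal{P}$, $$\eta([\![X,Y]\!]^{D,B},Z)=\eta([\![X,Y]\!]^D,Z)-(db)(X,Y,Z).$$
   Context: An almost para-Hermitian manifold $(\mathcal{P},\eta,K)$ is a manifold with $K\in\mathrm{End}(T\mathcal{P})$, $K^2=\mathbb{1}$, whose $\pm1$-eigenbundles $T_\pm$ have the same rank, and a pseudo-Riemannian metric $\eta$ with $\eta(K\cdot,K\cdot)=-\eta$. Then $T\mathcal{P}=T_+\oplus T_-$ and $T_\pm$ are maximally isotropic. The fundamental form is $\omega(X,Y)=\eta(KX,Y)$. The structure is para-Kähler if $T_+$ and $T_-$ are both Frobenius integrable and $d\omega=0$. Let $\mathring\nabla$ be the Levi-Civita connection of $\eta$. The canonical connection of an almost para-Hermitian structure $(\eta,K)$ is given by $\eta(\nabla^c_XY,Z)=\eta(\mathring\nabla_XY,Z)-\frac12(\mathring\nabla_X\omega)(Y,KZ)$, equivalently $\nabla^c_XY=\mathrm{P}_+\mathring\nabla_X\mathrm{P}_+Y+\mathrm{P}_-\mathring\nabla_X\mathrm{P}_-Y$ with $\mathrm{P}_\pm=\frac12(\mathbb{1}\pm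 K)$. The D-bracket of $(\eta,K)$ is $\eta([\![X,Y]\!]^D,Z)=\eta(\nabla^c_XY-\nabla^c_YX,Z)+\eta(\nabla^c_ZX,Y)$. $B$-transformation: in the splitting $T_+\oplus T_-$, $e^B=\begin{pmatrix}\mathbb{1}&0\\ B&\mathbb{1}\end{pmatrix}$ and $K_B=e^BKe^{-B}=\begin{pmatrix}\mathbb{1}&0\\ 2B&-\mathbb{1}\end{pmatrix}$; $(\eta,K_B)$ is an almost para-Hermitian structure (with the same $\eta$), and $[\![\ ,\ ]\!]^{D,B}$ is its D-bracket, i.e. $\eta([\![X,Y]\!]^{D,B},Z)=\eta(\nabla^{c,B}_XY-\nabla^{c,B}_YX,Z)+\eta(\nabla^{c,B}_ZX,Y)$, where $\nabla^{c,B}_XY=\mathrm{P}^B_+\mathring\nabla_X\mathrm{P}^B_+Y+\mathrm{P}^B_-\mathring\nabla_X\mathrm{P}^B_-Y$ with $\mathrm{P}^B_\pm=\frac12(\mathbb{1}\pm K_B)$ is the canonical connection of $(\eta,K_B)$. The two-form $b$ is $b(X,Y)=\eta(BX,Y)$, with $B$ extended by zero on $T_-$, and $d$ is the de Rham differential on $\mathcal{P}$. *)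

theory Defs
  imports "HOL-Analysis.Analysis" "HOL-Library.Function_Algebras"
begin

section \<open>Smooth manifolds\<close>

text \<open>A manifold is a Hausdorff, second countable type \<open>'m\<close> (the whole type is the underlying
  space) together with a smooth atlas of charts into \<open>'e\<close>. The atlas need not be maximal.\<close>

type_synonym ('m, 'e) atlas = "('m set \<times> ('m \<Rightarrow> 'e)) set"

text \<open>Only used on open sets \<open>S\<close>.\<close>

primrec Ck_on :: "nat \<Rightarrow> 'a::euclidean_space set \<Rightarrow> ('a \<Rightarrow> 'b::real_normed_vector) \<Rightarrow> bool" where
  "Ck_on 0 S f \<longleftrightarrow> continuous_on S f"
| "Ck_on (Suc k) S f \<longleftrightarrow>
     (\<forall>x\<in>S. f differentiable (at x)) \<and> (\<forall>v. Ck_on k S (\<lambda>x. frechet_derivative f (at x) v))"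

definition smooth_on :: "'a::euclidean_space set \<Rightarrow> ('a \<Rightarrow> 'b::real_normed_vector) \<Rightarrow> bool" where
  "smooth_on S f \<longleftrightarrow> (\<forall>k. Ck_on k S f)"

definition smooth_atlas ::
  "('m::{t2_space,second_countable_topology}, 'e::euclidean_space) atlas \<Rightarrow> bool" where
  "smooth_atlas \<A> \<longleftrightarrow>
     (\<Union>(U, \<phi>)\<in>\<A>. U) = UNIV \<and>
     (\<forall>(U, \<phi>)\<in>\<A>. open U \<and> open (\<phi> ` U) \<and> homeomorphism U (\<phi> ` U) \<phi> (inv_into U \<phi>)) \<and>
     (\<forall>(U, \<phi>)\<in>\<A>. \<forall>(V, \<psi>)\<in>\<A>. smooth_on (\<phi> ` (U \<inter> V)) (\<psi> \<circ> inv_into U \<phi>))"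

definition smooth_fun ::
  "('m::{t2_space,second_countable_topology}, 'e::euclidean_space) atlas \<Rightarrow> ('m \<Rightarrow> real) set" where
  "smooth_fun \<A> = {f. \<forall>(U, \<phi>)\<in>\<A>. smooth_on (\<phi> ` U) (f \<circ> inv_into U \<phi>)}"

section \<open>Tangent vectors and vector fields\<close>

text \<open>Addition and subtraction of functions come from \<open>Function_Algebras\<close>; we add the pointwise
  real scaling, so that \<open>dim\<close> applies to spaces of tangent vectors.\<close>

instantiation "fun" :: (type, real_vector) real_vector
begin

definition scaleR_fun :: "real \<Rightarrow> ('a \<Rightarrow> 'b) \<Rightarrow> 'a \<Rightarrow> 'b" where
  "scaleR_fun r f = (\<lambda>x. r *\<^sub>R f x)"

instance
  by standard (auto simp: scaleR_fun_def plus_fun_def scaleR_add_right scaleR_add_left)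

end

type_synonym 'm tvec = "('m \<Rightarrow> real) \<Rightarrow> real"
type_synonym 'm vfield = "'m \<Rightarrow> 'm tvec"
type_synonym 'm endo = "'m \<Rightarrow> 'm tvec \<Rightarrow> 'm tvec"
type_synonym 'm bilin = "'m \<Rightarrow> 'm tvec \<Rightarrow> 'm tvec \<Rightarrow> real"
type_synonym 'm connection = "'m vfield \<Rightarrow> 'm vfield \<Rightarrow> 'm vfield"

text \<open>Tangent vectors are derivations at \<open>p\<close> of the algebra of smooth functions. HOL functions being
  total, a derivation is given the value \<open>0\<close> on non-smooth functions, which makes its
  representation unique.\<close>

definition tangent_space ::
  "('m::{t2_space,second_countable_topology}, 'e::euclidean_space) atlas \<Rightarrow> 'm \<Rightarrow> 'm tvec set" where
  "tangent_space \<A> p = {v.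
     (\<forall>f\<in>smooth_fun \<A>. \<forall>g\<in>smooth_fun \<A>. v (\<lambda>x. f x + g x) = v f + v g) \<and>
     (\<forall>f\<in>smooth_fun \<A>. \<forall>c. v (\<lambda>x. c * f x) = c * v f) \<and>
     (\<forall>f\<in>smooth_fun \<A>. \<forall>g\<in>smooth_fun \<A>. v (\<lambda>x. f x * g x) = v f * g p + f p * v g) \<and>
     (\<forall>f. f \<notin> smooth_fun \<A> \<longrightarrow> v f = 0)}"

definition vfields ::
  "('m::{t2_space,second_countable_topology}, 'e::euclidean_space) atlas \<Rightarrow> 'm vfield set" where
  "vfields \<A> = {X. (\<forall>p. X p \<in> tangent_space \<A> p) \<and>
     (\<forall>f\<in>smooth_fun \<A>. (\<lambda>p. X p f) \<in> smooth_fun \<A>)}"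

definition lie_bracket ::
  "('m::{t2_space,second_countable_topology}, 'e::euclidean_space) atlas \<Rightarrow>
     'm vfield \<Rightarrow> 'm vfield \<Rightarrow> 'm vfield" where
  "lie_bracket \<A> X Y = (\<lambda>p f. if f \<in> smooth_fun \<A>
     then X p (\<lambda>q. Y q f) - Y p (\<lambda>q. X q f) else 0)"

section \<open>Bundles and tensors\<close>

text \<open>Subbundles of the tangent bundle are given by their fibres \<open>V p\<close>.\<close>

definition sections ::
  "('m::{t2_space,second_countable_topology}, 'e::euclidean_space) atlas \<Rightarrow>
     ('m \<Rightarrow> 'm tvec set) \<Rightarrow> 'm vfield set" where
  "sections \<A> V = {X \<in> vfields \<A>. \<forall>p. X p \<in> V p}"

definition ap :: "'m endo \<Rightarrow> 'm vfield \<Rightarrow> 'm vfield" where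
  "ap F X = (\<lambda>p. F p (X p))"

definition bundle_map ::
  "('m::{t2_space,second_countable_topology}, 'e::euclidean_space) atlas \<Rightarrow>
     ('m \<Rightarrow> 'm tvec set) \<Rightarrow> ('m \<Rightarrow> 'm tvec set) \<Rightarrow> 'm endo \<Rightarrow> bool" where
  "bundle_map \<A> V W F \<longleftrightarrow>
     (\<forall>p. (\<forall>v\<in>V p. F p v \<in> W p) \<and>
          (\<forall>v\<in>V p. \<forall>w\<in>V p. F p (v + w) = F p v + F p w) \<and>
          (\<forall>v\<in>V p. \<forall>c. F p (c *\<^sub>R v) = c *\<^sub>R F p v)) \<and>
     (\<forall>X\<in>sections \<A> V. ap F X \<in> sections \<A> W)"

definition ev :: "'m bilin \<Rightarrow> 'm vfield \<Rightarrow> 'm vfield \<Rightarrow> 'm \<Rightarrow> real" where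
  "ev g X Y = (\<lambda>p. g p (X p) (Y p))"

definition smooth_bilinear ::
  "('m::{t2_space,second_countable_topology}, 'e::euclidean_space) atlas \<Rightarrow> 'm bilin \<Rightarrow> bool" where
  "smooth_bilinear \<A> g \<longleftrightarrow>
     (\<forall>p. \<forall>u\<in>tangent_space \<A> p. \<forall>v\<in>tangent_space \<A> p. \<forall>w\<in>tangent_space \<A> p. \<forall>c.
        g p (u + v) w = g p u w + g p v w \<and> g p (c *\<^sub>R u) w = c * g p u w \<and>
        g p u (v + w) = g p u v + g p u w \<and> g p u (c *\<^sub>R w) = c * g p u w) \<and>
     (\<forall>X\<in>vfields \<A>. \<forall>Y\<in>vfields \<A>. ev g X Y \<in> smooth_fun \<A>)"

definition pseudo_riemannian ::
  "('m::{t2_space,second_countable_topology}, 'e::euclidean_space) atlas \<Rightarrow> 'm bilin \<Rightarrow> bool" where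
  "pseudo_riemannian \<A> \<eta> \<longleftrightarrow> smooth_bilinear \<A> \<eta> \<and>
     (\<forall>p. \<forall>v\<in>tangent_space \<A> p. \<forall>w\<in>tangent_space \<A> p. \<eta> p v w = \<eta> p w v) \<and>
     (\<forall>p. \<forall>v\<in>tangent_space \<A> p. (\<forall>w\<in>tangent_space \<A> p. \<eta> p v w = 0) \<longrightarrow> v = 0)"

text \<open>The de Rham differential of a two-form, by the invariant formula (normalised without a
  factor \<open>1/3\<close>).\<close>

definition ext_deriv ::
  "('m::{t2_space,second_countable_topology}, 'e::euclidean_space) atlas \<Rightarrow>
     'm bilin \<Rightarrow> 'm vfield \<Rightarrow> 'm vfield \<Rightarrow> 'm vfield \<Rightarrow> 'm \<Rightarrow> real" where
  "ext_deriv \<A> \<beta> X Y Z = (\<lambda>p.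
     X p (ev \<beta> Y Z) - Y p (ev \<beta> X Z) + Z p (ev \<beta> X Y)
     - ev \<beta> (lie_bracket \<A> X Y) Z p + ev \<beta> (lie_bracket \<A> X Z) Y p
     - ev \<beta> (lie_bracket \<A> Y Z) X p)"

section \<open>Para-Hermitian and para-Kaehler structures\<close>

definition T_plus ::
  "('m::{t2_space,second_countable_topology}, 'e::euclidean_space) atlas \<Rightarrow> 'm endo \<Rightarrow>
     'm \<Rightarrow> 'm tvec set" where
  "T_plus \<A> K p = {v \<in> tangent_space \<A> p. K p v = v}"

definition T_minus ::
  "('m::{t2_space,second_countable_topology}, 'e::euclidean_space) atlas \<Rightarrow> 'm endo \<Rightarrow>
     'm \<Rightarrow> 'm tvec set" where
  "T_minus \<A> K p = {v \<in> tangent_space \<A> p. K p v = - v}"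

definition P_plus :: "'m endo \<Rightarrow> 'm endo" where
  "P_plus K p v = (1/2) *\<^sub>R (v + K p v)"

definition P_minus :: "'m endo \<Rightarrow> 'm endo" where
  "P_minus K p v = (1/2) *\<^sub>R (v - K p v)"

definition almost_para_hermitian ::
  "('m::{t2_space,second_countable_topology}, 'e::euclidean_space) atlas \<Rightarrow>
     'm bilin \<Rightarrow> 'm endo \<Rightarrow> bool" where
  "almost_para_hermitian \<A> \<eta> K \<longleftrightarrow>
     pseudo_riemannian \<A> \<eta> \<and>
     bundle_map \<A> (tangent_space \<A>) (tangent_space \<A>) K \<and>
     (\<forall>p. \<forall>v\<in>tangent_space \<A> p. K p (K p v) = v) \<and>
     (\<forall>p. dim (T_plus \<A> K p) = dim (T_minus \<A> K p)) \<and>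
     (\<forall>p. \<forall>v\<in>tangent_space \<A> p. \<forall>w\<in>tangent_space \<A> p. \<eta> p (K p v) (K p w) = - \<eta> p v w)"

definition fundamental_form :: "'m bilin \<Rightarrow> 'm endo \<Rightarrow> 'm bilin" where
  "fundamental_form \<eta> K p v w = \<eta> p (K p v) w"

definition frobenius_integrable ::
  "('m::{t2_space,second_countable_topology}, 'e::euclidean_space) atlas \<Rightarrow>
     ('m \<Rightarrow> 'm tvec set) \<Rightarrow> bool" where
  "frobenius_integrable \<A> V \<longleftrightarrow>
     (\<forall>X\<in>sections \<A> V. \<forall>Y\<in>sections \<A> V. lie_bracket \<A> X Y \<in> sections \<A> V)"

definition para_kaehler ::
  "('m::{t2_space,second_countable_topology}, 'e::euclidean_space) atlas \<Rightarrow>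
     'm bilin \<Rightarrow> 'm endo \<Rightarrow> bool" where
  "para_kaehler \<A> \<eta> K \<longleftrightarrow>
     almost_para_hermitian \<A> \<eta> K \<and>
     frobenius_integrable \<A> (T_plus \<A> K) \<and> frobenius_integrable \<A> (T_minus \<A> K) \<and>
     (\<forall>X\<in>vfields \<A>. \<forall>Y\<in>vfields \<A>. \<forall>Z\<in>vfields \<A>. \<forall>p.
        ext_deriv \<A> (fundamental_form \<eta> K) X Y Z p = 0)"

section \<open>Connections and the D-bracket\<close>

definition affine_connection ::
  "('m::{t2_space,second_countable_topology}, 'e::euclidean_space) atlas \<Rightarrow>
     'm connection \<Rightarrow> bool" where
  "affine_connection \<A> N \<longleftrightarrow>
     (\<forall>X\<in>vfields \<A>. \<forall>Y\<in>vfields \<A>. N X Y \<in> vfields \<A>) \<and>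
     (\<forall>X\<in>vfields \<A>. \<forall>Y\<in>vfields \<A>. \<forall>Z\<in>vfields \<A>.
        N (X + Y) Z = N X Z + N Y Z \<and> N X (Y + Z) = N X Y + N X Z) \<and>
     (\<forall>f\<in>smooth_fun \<A>. \<forall>X\<in>vfields \<A>. \<forall>Y\<in>vfields \<A>.
        N (\<lambda>p. f p *\<^sub>R X p) Y = (\<lambda>p. f p *\<^sub>R N X Y p) \<and>
        N X (\<lambda>p. f p *\<^sub>R Y p) = (\<lambda>p. X p f *\<^sub>R Y p + f p *\<^sub>R N X Y p))"

definition levi_civita ::
  "('m::{t2_space,second_countable_topology}, 'e::euclidean_space) atlas \<Rightarrow>
     'm bilin \<Rightarrow> 'm connection \<Rightarrow> bool" where
  "levi_civita \<A> \<eta> N \<longleftrightarrow>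
     affine_connection \<A> N \<and>
     (\<forall>X\<in>vfields \<A>. \<forall>Y\<in>vfields \<A>. N X Y - N Y X = lie_bracket \<A> X Y) \<and>
     (\<forall>X\<in>vfields \<A>. \<forall>Y\<in>vfields \<A>. \<forall>Z\<in>vfields \<A>. \<forall>p.
        X p (ev \<eta> Y Z) = ev \<eta> (N X Y) Z p + ev \<eta> Y (N X Z) p)"

definition canonical_connection :: "'m endo \<Rightarrow> 'm connection \<Rightarrow> 'm connection" where
  "canonical_connection K N X Y =
     ap (P_plus K) (N X (ap (P_plus K) Y)) + ap (P_minus K) (N X (ap (P_minus K) Y))"

text \<open>As \<open>\<eta>\<close> is nondegenerate, the condition below determines \<open>D\<close> uniquely on vector fields; \<open>N\<close> is
  meant to be the Levi-Civita connection of \<open>\<eta>\<close>.\<close>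

definition is_D_bracket ::
  "('m::{t2_space,second_countable_topology}, 'e::euclidean_space) atlas \<Rightarrow>
     'm bilin \<Rightarrow> 'm connection \<Rightarrow> 'm endo \<Rightarrow> ('m vfield \<Rightarrow> 'm vfield \<Rightarrow> 'm vfield) \<Rightarrow> bool" where
  "is_D_bracket \<A> \<eta> N K D \<longleftrightarrow>
     (\<forall>X\<in>vfields \<A>. \<forall>Y\<in>vfields \<A>. D X Y \<in> vfields \<A> \<and>
        (\<forall>Z\<in>vfields \<A>. \<forall>p. ev \<eta> (D X Y) Z p =
           ev \<eta> (canonical_connection K N X Y - canonical_connection K N Y X) Z p
           + ev \<eta> (canonical_connection K N Z X) Y p))"

section \<open>B-transformations\<close>

text \<open>A map \<open>B : T\<^sub>+ \<rightarrow> T\<^sub>-\<close>, extended by zero on \<open>T\<^sub>-\<close>.\<close>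

definition ext_zero :: "'m endo \<Rightarrow> 'm endo \<Rightarrow> 'm endo" where
  "ext_zero K B p v = B p (P_plus K p v)"

definition exp_B :: "'m endo \<Rightarrow> 'm endo \<Rightarrow> 'm endo" where
  "exp_B K B p v = v + ext_zero K B p v"

definition exp_minus_B :: "'m endo \<Rightarrow> 'm endo \<Rightarrow> 'm endo" where
  "exp_minus_B K B p v = v - ext_zero K B p v"

definition B_transform :: "'m endo \<Rightarrow> 'm endo \<Rightarrow> 'm endo" where
  "B_transform K B p v = exp_B K B p (K p (exp_minus_B K B p v))"

definition B_form :: "'m bilin \<Rightarrow> 'm endo \<Rightarrow> 'm endo \<Rightarrow> 'm bilin" where
  "B_form \<eta> K B p v w = \<eta> p (ext_zero K B p v) w"

end

theory Submission
  imports Defs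
begin

text \<open>Write \<open>\<beta>\<close> for \<open>B\<close> extended by zero, so that \<open>K\<^sub>B = K + 2\<beta>\<close>, and \<open>\<nabla>\<close> for the Levi-Civita
  connection. By the Koszul formula, integrability of \<open>T\<^sub>-\<close> and \<open>d\<omega> = 0\<close> give \<open>\<eta>(\<nabla>\<^sub>X U, V) = 0\<close>
  for sections \<open>U\<close>, \<open>V\<close> of \<open>T\<^sub>-\<close>. Hence the canonical connections of \<open>K\<^sub>B\<close> and \<open>K\<close> differ by
  \<open>- \<nabla>\<beta>\<close>. As \<open>\<nabla>\<close> is metric and torsion-free, \<open>db\<close> is the alternation of \<open>\<nabla>b\<close>, which is exactly
  the resulting difference of D-brackets. Pairing only with global vector fields avoids extending
  tangent vectors by bump functions.\<close>

section \<open>Linear structure on vector fields\<close>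

lemma Ck_on_cong:
  assumes "open S" "\<And>x. x \<in> S \<Longrightarrow> f x = g x" "Ck_on k S f"
  shows "Ck_on k S g"
  using assms(2,3)
proof (induction k arbitrary: f g)
  case 0
  then show ?case using continuous_on_cong[of S S f g] by simp
next
  case (Suc k)
  have d: "(g has_derivative frechet_derivative f (at x)) (at x)" if "x \<in> S" for x
  proof -
    have "(f has_derivative frechet_derivative f (at x)) (at x)"
      using Suc.prems(2) that by (simp add: frechet_derivative_works)
    then show ?thesis
      using has_derivative_transform_within_open[OF _ assms(1) that] Suc.prems(1) by blast
  qed
  have "Ck_on k S (\<lambda>x. frechet_derivative g (at x) v)" for v
    using Suc.IH[of "\<lambda>x. frechet_derivative f (at x) v"] Suc.prems(2)
      frechet_derivative_at[OF d] by simp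
  then show ?case using d by (auto simp: differentiable_def)
qed

lemma Ck_on_const: "Ck_on k S (\<lambda>x. c)"
  by (induction k arbitrary: c) auto

text \<open>The formula for the derivative of a sum is available only at points of \<open>S\<close>,
  not as an equality of functions, so the induction hypothesis is carried over by
  \<open>Ck_on_cong\<close>, which needs \<open>S\<close> open.\<close>

lemma Ck_on_add:
  assumes "open S" "Ck_on k S f" "Ck_on k S g"
  shows "Ck_on k S (\<lambda>x. f x + g x)"
  using assms(2,3)
proof (induction k arbitrary: f g)
  case 0
  then show ?case by (simp add: continuous_on_add)
next
  case (Suc k)
  have d: "((\<lambda>x. f x + g x) has_derivative
      (\<lambda>v. frechet_derivative f (at x) v + frechet_derivative g (at x) v)) (at x)"
    if "x \<in> S" for x
    using Suc.prems that by (intro has_derivative_add) (simp_all add: frechet_derivative_works)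
  have "Ck_on k S (\<lambda>x. frechet_derivative (\<lambda>x. f x + g x) (at x) v)" for v
    by (rule Ck_on_cong[OF assms(1) _ Suc.IH[of "\<lambda>x. frechet_derivative f (at x) v"
            "\<lambda>x. frechet_derivative g (at x) v"]])
      (use Suc.prems frechet_derivative_at[OF d, symmetric] in \<open>auto dest: fun_cong\<close>)
  then show ?case using d by (auto simp: differentiable_def)
qed

lemma Ck_on_scaleR:
  assumes "open S" "Ck_on k S f"
  shows "Ck_on k S (\<lambda>x. c *\<^sub>R f x)"
  using assms(2)
proof (induction k arbitrary: f)
  case 0
  then show ?case by (simp add: continuous_on_scaleR)
next
  case (Suc k)
  have d: "((\<lambda>x. c *\<^sub>R f x) has_derivative (\<lambda>v. c *\<^sub>R frechet_derivative f (at x) v)) (at x)"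
    if "x \<in> S" for x
    using Suc.prems that by (intro has_derivative_scaleR_right) (simp add: frechet_derivative_works)
  have "Ck_on k S (\<lambda>x. frechet_derivative (\<lambda>x. c *\<^sub>R f x) (at x) v)" for v
    by (rule Ck_on_cong[OF assms(1) _ Suc.IH[of "\<lambda>x. frechet_derivative f (at x) v"]])
      (use Suc.prems frechet_derivative_at[OF d, symmetric] in \<open>auto dest: fun_cong\<close>)
  then show ?case using d by (auto simp: differentiable_def)
qed

lemma subspace_smooth_fun:
  assumes "smooth_atlas \<A>"
  shows "subspace (smooth_fun \<A>)"
proof -
  \<comment> \<open>The C^k closure lemmas are applied in each chart, on its open image.\<close>
  have "open (\<phi> ` U)" if "(U, \<phi>) \<in> \<A>" for U \<phi>
    using assms that by (auto simp: smooth_atlas_def)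
  then show ?thesis
    unfolding subspace_def smooth_fun_def smooth_on_def comp_def
    by (auto simp: scaleR_fun_def zero_fun_def plus_fun_def split: prod.splits
        intro!: Ck_on_const Ck_on_add Ck_on_scaleR[where 'b = real, unfolded real_scaleR_def]
        dest!: bspec)
qed

lemma subspace_tangent_space: "subspace (tangent_space \<A> p)"
  unfolding subspace_def tangent_space_def
  by (auto simp: scaleR_fun_def plus_fun_def zero_fun_def algebra_simps)

lemma subspace_vfields:
  assumes "smooth_atlas \<A>"
  shows "subspace (vfields \<A>)"
proof -
  note S = subspace_smooth_fun[OF assms, unfolded subspace_def]
  have "(\<lambda>p. 0) \<in> smooth_fun \<A>"
    using S by (simp add: zero_fun_def)
  moreover have "(\<lambda>p. f p + g p) \<in> smooth_fun \<A>" if "f \<in> smooth_fun \<A>" "g \<in> smooth_fun \<A>" for f g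
    using S that by (simp add: plus_fun_def)
  moreover have "(\<lambda>p. c * f p) \<in> smooth_fun \<A>" if "f \<in> smooth_fun \<A>" for c f
    using S that by (simp add: scaleR_fun_def)
  ultimately show ?thesis
    using subspace_tangent_space[of \<A>] unfolding subspace_def vfields_def
    by (simp add: scaleR_fun_def plus_fun_def zero_fun_def)
qed

section \<open>B-transformations of a para-Kaehler structure\<close>

text \<open>The D-brackets are left out: the argument takes place at the level of connections, and
  the brackets enter only in the final comparison.\<close>

locale para_kaehler_B =
  fixes \<A> :: "('m::{t2_space,second_countable_topology}, 'e::euclidean_space) atlas"
    and \<eta> :: "'m bilin" and K B :: "'m endo" and N :: "'m connection"
  assumes atlas: "smooth_atlas \<A>"
    and pk: "para_kaehler \<A> \<eta> K"
    and B: "bundle_map \<A> (T_plus \<A> K) (T_minus \<A> K) B"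
    and B_skew: "\<And>X Y. X \<in> sections \<A> (T_plus \<A> K) \<Longrightarrow> Y \<in> sections \<A> (T_plus \<A> K) \<Longrightarrow>
           ev \<eta> (ap B X) Y = - ev \<eta> X (ap B Y)"
    and lc: "levi_civita \<A> \<eta> N"
begin

abbreviation "\<beta> \<equiv> ap (ext_zero K B)"
abbreviation "Pp \<equiv> ap (P_plus K)"
abbreviation "Pm \<equiv> ap (P_minus K)"

lemmas T_add = subspace_add[OF subspace_tangent_space[of \<A>]]
  and T_diff = subspace_diff[OF subspace_tangent_space[of \<A>]]
  and T_scale = subspace_scale[OF subspace_tangent_space[of \<A>]]
  and T_neg = subspace_neg[OF subspace_tangent_space[of \<A>]]
  and V_add = subspace_add[OF subspace_vfields[OF atlas]]
  and V_diff = subspace_diff[OF subspace_vfields[OF atlas]]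
  and V_scale = subspace_scale[OF subspace_vfields[OF atlas]]

section \<open>Pointwise algebra of \<open>K\<close> and \<eta>\<close>

lemma aph: "almost_para_hermitian \<A> \<eta> K"
  using pk by (simp add: para_kaehler_def)

lemma vfields_T: "X \<in> vfields \<A> \<Longrightarrow> X p \<in> tangent_space \<A> p"
  by (simp add: vfields_def)

lemma K_T: "v \<in> tangent_space \<A> p \<Longrightarrow> K p v \<in> tangent_space \<A> p"
  and K_add: "v \<in> tangent_space \<A> p \<Longrightarrow> w \<in> tangent_space \<A> p \<Longrightarrow> K p (v + w) = K p v + K p w"
  and K_scale: "v \<in> tangent_space \<A> p \<Longrightarrow> K p (c *\<^sub>R v) = c *\<^sub>R K p v"
  and K_K: "v \<in> tangent_space \<A> p \<Longrightarrow> K p (K p v) = v"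
  and \<eta>_K_K: "v \<in> tangent_space \<A> p \<Longrightarrow> w \<in> tangent_space \<A> p \<Longrightarrow>
        \<eta> p (K p v) (K p w) = - \<eta> p v w"
  and K_vfields: "X \<in> vfields \<A> \<Longrightarrow> ap K X \<in> vfields \<A>"
  using aph by (auto simp: almost_para_hermitian_def bundle_map_def sections_def vfields_T)

lemma K_diff:
  "v \<in> tangent_space \<A> p \<Longrightarrow> w \<in> tangent_space \<A> p \<Longrightarrow> K p (v - w) = K p v - K p w"
  using K_add[of v p "- w"] K_scale[of w p "-1"] by (simp add: T_neg)

lemma \<eta>_add_left: "u \<in> tangent_space \<A> p \<Longrightarrow> v \<in> tangent_space \<A> p \<Longrightarrow> w \<in> tangent_space \<A> p \<Longrightarrow>
        \<eta> p (u + v) w = \<eta> p u w + \<eta> p v w"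
  and \<eta>_scale_left: "u \<in> tangent_space \<A> p \<Longrightarrow> w \<in> tangent_space \<A> p \<Longrightarrow>
        \<eta> p (c *\<^sub>R u) w = c * \<eta> p u w"
  and \<eta>_sym: "u \<in> tangent_space \<A> p \<Longrightarrow> w \<in> tangent_space \<A> p \<Longrightarrow> \<eta> p u w = \<eta> p w u"
  using aph
  by (simp_all add: almost_para_hermitian_def pseudo_riemannian_def smooth_bilinear_def)

lemma \<eta>_minus_left: "u \<in> tangent_space \<A> p \<Longrightarrow> w \<in> tangent_space \<A> p \<Longrightarrow> \<eta> p (- u) w = - \<eta> p u w"
  using \<eta>_scale_left[of u p w "-1"] by simp

lemma \<eta>_minus_right: "u \<in> tangent_space \<A> p \<Longrightarrow> w \<in> tangent_space \<A> p \<Longrightarrow> \<eta> p u (- w) = - \<eta> p u w"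
  using \<eta>_minus_left[of w p u] by (simp add: \<eta>_sym[of u] T_neg)

lemma \<eta>_diff_left: "u \<in> tangent_space \<A> p \<Longrightarrow> v \<in> tangent_space \<A> p \<Longrightarrow> w \<in> tangent_space \<A> p \<Longrightarrow>
        \<eta> p (u - v) w = \<eta> p u w - \<eta> p v w"
  using \<eta>_add_left[of u p "- v" w] by (simp add: T_neg \<eta>_minus_left)

text \<open>Put \<open>K p w\<close> into the second slot of the anti-isometry identity and use that
  \<open>K\<close> squares to the identity.\<close>

lemma \<eta>_K_left:
  "u \<in> tangent_space \<A> p \<Longrightarrow> w \<in> tangent_space \<A> p \<Longrightarrow> \<eta> p (K p u) w = - \<eta> p u (K p w)"
  using \<eta>_K_K[of u p "K p w"] by (simp add: K_T K_K)

lemma ev_sym: "X \<in> vfields \<A> \<Longrightarrow> Y \<in> vfields \<A> \<Longrightarrow> ev \<eta> X Y = ev \<eta> Y X"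
  by (auto simp: ev_def fun_eq_iff intro: \<eta>_sym vfields_T)

lemma ev_add_left: "X \<in> vfields \<A> \<Longrightarrow> Y \<in> vfields \<A> \<Longrightarrow> Z \<in> vfields \<A> \<Longrightarrow>
    ev \<eta> (X + Y) Z p = ev \<eta> X Z p + ev \<eta> Y Z p"
  by (simp add: ev_def \<eta>_add_left vfields_T)

lemma ev_diff_left: "X \<in> vfields \<A> \<Longrightarrow> Y \<in> vfields \<A> \<Longrightarrow> Z \<in> vfields \<A> \<Longrightarrow>
    ev \<eta> (X - Y) Z p = ev \<eta> X Z p - ev \<eta> Y Z p"
  by (simp add: ev_def \<eta>_diff_left vfields_T)

section \<open>Eigenbundle projections, isotropy and skewness of \<beta>\<close>

lemma P_T: "v \<in> tangent_space \<A> p \<Longrightarrow> P_plus K p v \<in> T_plus \<A> K p"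
  and M_T: "v \<in> tangent_space \<A> p \<Longrightarrow> P_minus K p v \<in> T_minus \<A> K p"
  by (auto simp: P_plus_def P_minus_def T_plus_def T_minus_def K_T K_K K_add K_diff K_scale
      T_add T_diff T_scale algebra_simps)

lemma Pp_eq: "Pp X = (1/2) *\<^sub>R (X + ap K X)" and Pm_eq: "Pm X = (1/2) *\<^sub>R (X - ap K X)"
  by (auto simp: ap_def P_plus_def P_minus_def fun_eq_iff scaleR_fun_def)

lemma Pp_sections: "X \<in> vfields \<A> \<Longrightarrow> Pp X \<in> sections \<A> (T_plus \<A> K)"
  and Pm_sections: "X \<in> vfields \<A> \<Longrightarrow> Pm X \<in> sections \<A> (T_minus \<A> K)"
proof -
  assume X: "X \<in> vfields \<A>"
  have "Pp X p \<in> T_plus \<A> K p" "Pm X p \<in> T_minus \<A> K p" for p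
    using X by (simp_all add: ap_def P_T M_T vfields_T)
  moreover have "Pp X \<in> vfields \<A>" "Pm X \<in> vfields \<A>"
    using X by (simp_all add: Pp_eq Pm_eq V_scale V_add V_diff K_vfields)
  ultimately show "Pp X \<in> sections \<A> (T_plus \<A> K)" "Pm X \<in> sections \<A> (T_minus \<A> K)"
    by (simp_all add: sections_def)
qed

lemma Pp_Pm: "Pp X + Pm X = X"
  by (auto simp: ap_def P_plus_def P_minus_def fun_eq_iff scaleR_fun_def field_simps)

lemma \<beta>_eq: "\<beta> X = ap B (Pp X)"
  by (simp add: ap_def ext_zero_def)

lemma \<beta>_sections: "X \<in> vfields \<A> \<Longrightarrow> \<beta> X \<in> sections \<A> (T_minus \<A> K)"
  using B Pp_sections by (simp add: \<beta>_eq bundle_map_def)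

lemma sections_vfields: "X \<in> sections \<A> V \<Longrightarrow> X \<in> vfields \<A>"
  by (simp add: sections_def)

lemmas proj_vfields = Pp_sections[THEN sections_vfields] Pm_sections[THEN sections_vfields]
  \<beta>_sections[THEN sections_vfields]

text \<open>On either eigenbundle the two signs from \<open>K\<close> cancel, so \<eta>(Ku, Kw)
  equals both \<eta>(u, w) and its negative.\<close>

lemma T_plus_isotropic: "u \<in> T_plus \<A> K p \<Longrightarrow> w \<in> T_plus \<A> K p \<Longrightarrow> \<eta> p u w = 0"
  and T_minus_isotropic: "u \<in> T_minus \<A> K p \<Longrightarrow> w \<in> T_minus \<A> K p \<Longrightarrow> \<eta> p u w = 0"
  using \<eta>_K_K[of u p w]
  by (auto simp: T_plus_def T_minus_def T_neg \<eta>_minus_left \<eta>_minus_right)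

lemma ev_plus_plus:
  "X \<in> sections \<A> (T_plus \<A> K) \<Longrightarrow> Y \<in> sections \<A> (T_plus \<A> K) \<Longrightarrow> ev \<eta> X Y = (\<lambda>p. 0)"
  and ev_minus_minus:
  "X \<in> sections \<A> (T_minus \<A> K) \<Longrightarrow> Y \<in> sections \<A> (T_minus \<A> K) \<Longrightarrow> ev \<eta> X Y = (\<lambda>p. 0)"
  by (auto simp: ev_def sections_def T_plus_isotropic T_minus_isotropic)

lemma ev_split:
  assumes "X \<in> vfields \<A>" "Y \<in> vfields \<A>"
  shows "ev \<eta> X Y p = ev \<eta> X (Pp Y) p + ev \<eta> X (Pm Y) p"
  using ev_add_left[of "Pp Y" "Pm Y" X p] assms
  by (simp add: Pp_Pm ev_sym[of X] proj_vfields)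

text \<open>By isotropy both sides equal \<eta>(\<open>Pp X\<close>, \<open>Pm Y\<close>). Thus the
  two projections are adjoint to each other with respect to \<eta>.\<close>

lemma ev_Pp_left:
  assumes "X \<in> vfields \<A>" "Y \<in> vfields \<A>"
  shows "ev \<eta> (Pp X) Y p = ev \<eta> X (Pm Y) p"
  using ev_split[of "Pp X" Y p] ev_add_left[of "Pp X" "Pm X" "Pm Y" p] assms
  by (simp add: Pp_Pm proj_vfields ev_plus_plus ev_minus_minus Pp_sections Pm_sections)

lemma ev_Pm_left:
  assumes "X \<in> vfields \<A>" "Y \<in> vfields \<A>"
  shows "ev \<eta> (Pm X) Y p = ev \<eta> X (Pp Y) p"
  using ev_split[of "Pm X" Y p] ev_add_left[of "Pp X" "Pm X" "Pp Y" p] assms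
  by (simp add: Pp_Pm proj_vfields ev_plus_plus ev_minus_minus Pp_sections Pm_sections)

text \<open>Skewness of \<open>B\<close> is given only on sections of \<open>T_plus\<close>. Since
  \<beta> takes values in the isotropic \<open>T_minus\<close>, the \<open>T_minus\<close>
  components of \<open>X\<close> and \<open>Y\<close> contribute nothing to either side.\<close>

lemma \<beta>_skew:
  assumes "X \<in> vfields \<A>" "Y \<in> vfields \<A>"
  shows "ev \<eta> (\<beta> X) Y p = - ev \<eta> X (\<beta> Y) p"
proof -
  have "ev \<eta> (\<beta> X) Y p = ev \<eta> (ap B (Pp X)) (Pp Y) p"
    using assms by (simp add: ev_split[of "\<beta> X" Y] proj_vfields ev_minus_minus \<beta>_sections
        Pm_sections) (simp add: \<beta>_eq)
  also have "\<dots> = - ev \<eta> (Pp X) (\<beta> Y) p"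
    using B_skew[OF Pp_sections Pp_sections, OF assms] by (simp add: \<beta>_eq)
  also have "ev \<eta> (Pp X) (\<beta> Y) p = ev \<eta> X (\<beta> Y) p"
    using ev_add_left[of "Pp X" "Pm X" "\<beta> Y" p] assms
    by (simp add: Pp_Pm proj_vfields ev_minus_minus \<beta>_sections Pm_sections)
  finally show ?thesis .
qed

section \<open>The Levi-Civita connection preserves \<open>T_minus\<close>\<close>

lemma N_vfields: "X \<in> vfields \<A> \<Longrightarrow> Y \<in> vfields \<A> \<Longrightarrow> N X Y \<in> vfields \<A>"
  and N_add_left: "X \<in> vfields \<A> \<Longrightarrow> Y \<in> vfields \<A> \<Longrightarrow> Z \<in> vfields \<A> \<Longrightarrow>
        N (X + Y) Z = N X Z + N Y Z"
  and N_add_right: "X \<in> vfields \<A> \<Longrightarrow> Y \<in> vfields \<A> \<Longrightarrow> Z \<in> vfields \<A> \<Longrightarrow>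
        N X (Y + Z) = N X Y + N X Z"
  and torsion_free: "X \<in> vfields \<A> \<Longrightarrow> Y \<in> vfields \<A> \<Longrightarrow> lie_bracket \<A> X Y = N X Y - N Y X"
  and metric: "X \<in> vfields \<A> \<Longrightarrow> Y \<in> vfields \<A> \<Longrightarrow> Z \<in> vfields \<A> \<Longrightarrow>
        X p (ev \<eta> Y Z) = ev \<eta> (N X Y) Z p + ev \<eta> Y (N X Z) p"
  using lc unfolding levi_civita_def affine_connection_def by simp_all

text \<open>Used to differentiate the identically vanishing pairing of two sections of
  \<open>T_minus\<close>.\<close>

lemma vfields_zero: "X \<in> vfields \<A> \<Longrightarrow> X p (\<lambda>p. 0) = 0"
proof -
  assume X: "X \<in> vfields \<A>"
  \<comment> \<open>A smooth function at hand: the zero function is 0 times it, and derivations are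
    homogeneous on smooth functions.\<close>
  have "ev \<eta> X X \<in> smooth_fun \<A>"
    using aph X by (simp add: almost_para_hermitian_def pseudo_riemannian_def smooth_bilinear_def)
  then have "X p (\<lambda>x. 0 * ev \<eta> X X x) = 0 * X p (ev \<eta> X X)"
    using vfields_T[OF X, of p] unfolding tangent_space_def by blast
  then show ?thesis by simp
qed

text \<open>Differentiate \<eta>(U, V) = 0 along \<open>X\<close>, using that the connection is
  metric.\<close>

lemma N_minus_minus_swap:
  assumes "X \<in> vfields \<A>" "U \<in> sections \<A> (T_minus \<A> K)" "V \<in> sections \<A> (T_minus \<A> K)"
  shows "ev \<eta> (N X U) V p = - ev \<eta> (N X V) U p"
  using metric[of X U V p] assms ev_sym[of U "N X V"]
  by (simp add: ev_minus_minus sections_vfields N_vfields vfields_zero)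

text \<open>Move \<open>K\<close> to the second argument, where it acts by a sign. The first
  identity is between functions because the exterior derivative also differentiates it; the second
  is needed only at a point.\<close>

lemma omega_T_minus:
  "X \<in> vfields \<A> \<Longrightarrow> Y \<in> sections \<A> (T_minus \<A> K) \<Longrightarrow>
    ev (fundamental_form \<eta> K) X Y = ev \<eta> X Y"
  and omega_T_plus:
  "X \<in> vfields \<A> \<Longrightarrow> Y \<in> sections \<A> (T_plus \<A> K) \<Longrightarrow>
    ev (fundamental_form \<eta> K) X Y p = - ev \<eta> X Y p"
  by (simp_all add: ev_def fundamental_form_def \<eta>_K_left vfields_T sections_def
      T_plus_def T_minus_def \<eta>_minus_right)

text \<open>Split \<open>X\<close> along the eigenbundles: the \<open>T_minus\<close> part is
  handled by integrability of \<open>T_minus\<close>, the \<open>T_plus\<close> part by closedness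
  of \<omega>.\<close>

lemma N_minus_minus:
  assumes X: "X \<in> vfields \<A>" and U: "U \<in> sections \<A> (T_minus \<A> K)"
    and V: "V \<in> sections \<A> (T_minus \<A> K)"
  shows "ev \<eta> (N X U) V p = 0"
proof -
  note [simp] = N_vfields sections_vfields ev_diff_left torsion_free
  have bracket: "ev \<eta> (lie_bracket \<A> V' W') U' p = 0"
    if "U' \<in> sections \<A> (T_minus \<A> K)" "V' \<in> sections \<A> (T_minus \<A> K)"
      "W' \<in> sections \<A> (T_minus \<A> K)" for U' V' W'
    using that pk ev_minus_minus by (simp add: para_kaehler_def frobenius_integrable_def)
  have minus: "ev \<eta> (N W U) V p = 0" if W: "W \<in> sections \<A> (T_minus \<A> K)" for W
  proof -
    note S = N_minus_minus_swap[OF sections_vfields, where p = p]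
    \<comment> \<open>By \<open>bracket\<close> and zero torsion, \<eta>(\<open>N W U\<close>, V) is
      symmetric in its first two slots; by \<open>S\<close> it is skew in its last two. A trilinear
      expression with both symmetries vanishes.\<close>
    show ?thesis
      using bracket[OF U W V] bracket[OF V W U] bracket[OF W U V] S[OF W U V]
        S[OF U W V] S[OF V W U] W U V
      by simp
  qed
  have plus: "ev \<eta> (N W U) V p = 0" if W: "W \<in> sections \<A> (T_plus \<A> K)" for W
  proof -
    have "ext_deriv \<A> (fundamental_form \<eta> K) W U V p = 0"
      using pk U V W by (simp add: para_kaehler_def)
    \<comment> \<open>Expanding by metricity and zero torsion, all terms cancel except
      -\<eta>(\<open>N W U\<close>, V) + \<eta>(\<open>N W V\<close>, U), which is -2
      \<eta>(\<open>N W U\<close>, V) by the swap.\<close>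
    then show ?thesis
      using metric[of U W V p] metric[of V W U p] N_minus_minus_swap[OF sections_vfields[OF W] U V, of p]
        ev_sym[of W "N U V"] ev_sym[of W "N V U"] U V W
      by (simp add: ext_deriv_def omega_T_minus omega_T_plus ev_minus_minus vfields_zero
          V_diff)
  qed
  have "N X U = N (Pp X) U + N (Pm X) U"
    using N_add_left[of "Pp X" "Pm X" U] X U by (simp add: Pp_Pm proj_vfields)
  then show ?thesis
    using plus[OF Pp_sections[OF X]] minus[OF Pm_sections[OF X]] X U V
    by (simp add: ev_add_left proj_vfields)
qed

section \<open>Projections and canonical connection of the transformed structure\<close>

lemma P_B_transform:
  assumes v: "v \<in> tangent_space \<A> p"
  shows "P_plus (B_transform K B) p v = P_plus K p v + ext_zero K B p v"
    and "P_minus (B_transform K B) p v = P_minus K p v - ext_zero K B p v"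
proof -
  let ?b = "ext_zero K B p v"
  have b: "?b \<in> T_minus \<A> K p"
    using B P_T[OF v] by (simp add: ext_zero_def bundle_map_def)
  then have Kb: "K p ?b = - ?b" and bT: "?b \<in> tangent_space \<A> p"
    by (simp_all add: T_minus_def)
  \<comment> \<open>\<open>K p v + ?b\<close> is \<open>K\<close> applied to \<open>v - ?b\<close>,
    the sign changing because \<open>?b\<close> lies in \<open>T_minus\<close>. Its
    \<open>T_plus\<close> part is that of \<open>v\<close>, so the outer \<open>exp_B\<close> adds
    \<open>?b\<close> once more.\<close>
  have "P_plus K p (K p v + ?b) = P_plus K p v"
    using v bT by (simp add: P_plus_def K_add K_T K_K Kb)
  then have "ext_zero K B p (K p v + ?b) = ?b"
    by (simp add: ext_zero_def)
  then have K_B: "B_transform K B p v = K p v + 2 *\<^sub>R ?b"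
    using v bT by (simp add: B_transform_def exp_minus_B_def exp_B_def K_diff Kb scaleR_2)
  show "P_plus (B_transform K B) p v = P_plus K p v + ?b"
    and "P_minus (B_transform K B) p v = P_minus K p v - ?b"
    by (simp_all add: P_plus_def P_minus_def K_B algebra_simps)
qed

lemma ap_P_B_transform:
  assumes "X \<in> vfields \<A>"
  shows "ap (P_plus (B_transform K B)) X = Pp X + \<beta> X"
    and "ap (P_minus (B_transform K B)) X = Pm X - \<beta> X"
  using assms by (auto simp: ap_def P_B_transform vfields_T fun_eq_iff)

lemma canonical_connection_vfields:
  assumes "X \<in> vfields \<A>" "Y \<in> vfields \<A>"
  shows "canonical_connection K N X Y \<in> vfields \<A>"
    and "canonical_connection (B_transform K B) N X Y \<in> vfields \<A>"
  using assms by (simp_all add: canonical_connection_def ap_P_B_transform V_add V_diff proj_vfields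
      N_vfields)

lemma N_diff_right:
  assumes "X \<in> vfields \<A>" "Y \<in> vfields \<A>" "Z \<in> vfields \<A>"
  shows "N X (Y - Z) = N X Y - N X Z"
  using N_add_right[of X "Y - Z" Z] assms by (simp add: V_diff)

text \<open>The correction is -\<eta>((\<nabla>\<beta>)(X, Y), Z). The adjointness rules move every
  projection and every outer \<beta> onto \<open>Z\<close>; then \<open>N_minus_minus\<close>
  removes the terms quadratic in \<beta> and those pairing two \<open>T_minus\<close>
  directions.\<close>

lemma canonical_connection_B_transform:
  assumes X: "X \<in> vfields \<A>" and Y: "Y \<in> vfields \<A>" and Z: "Z \<in> vfields \<A>"
  shows "ev \<eta> (canonical_connection (B_transform K B) N X Y) Z p =
    ev \<eta> (canonical_connection K N X Y) Z p + ev \<eta> (\<beta> (N X Y)) Z p - ev \<eta> (N X (\<beta> Y)) Z p"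
proof -
  note [simp] = proj_vfields N_vfields V_add V_diff ev_add_left ev_diff_left
    N_add_right N_diff_right \<beta>_skew ev_Pp_left ev_Pm_left
    N_minus_minus \<beta>_sections Pm_sections Pp_sections
  have "N X Y = N X (Pp Y) + N X (Pm Y)"
    using N_add_right[of X "Pp Y" "Pm Y"] X Y by (simp add: Pp_Pm)
  \<comment> \<open>\<open>\<beta> Z\<close> lies in \<open>T_minus\<close>, so the derivative of
    \<open>Pm Y\<close> pairs to zero with it.\<close>
  then have "ev \<eta> (N X Y) (\<beta> Z) p = ev \<eta> (N X (Pp Y)) (\<beta> Z) p"
    using X Y Z by simp
  moreover have "ev \<eta> (N X (\<beta> Y)) Z p = ev \<eta> (N X (\<beta> Y)) (Pp Z) p"
    using X Y Z by (simp add: ev_split[of _ Z])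
  ultimately show ?thesis
    using X Y Z by (simp add: canonical_connection_def ap_P_B_transform)
qed

text \<open>Each bracket on the right is (\<nabla>b) with the direction of differentiation first:
  zero torsion turns the Lie brackets into covariant derivatives, and metricity expands the
  differentiated pairings.\<close>

lemma ext_deriv_B_form:
  assumes X: "X \<in> vfields \<A>" and Y: "Y \<in> vfields \<A>" and Z: "Z \<in> vfields \<A>"
  shows "ext_deriv \<A> (B_form \<eta> K B) X Y Z p =
      (ev \<eta> (N X (\<beta> Y)) Z p - ev \<eta> (\<beta> (N X Y)) Z p)
    - (ev \<eta> (N Y (\<beta> X)) Z p - ev \<eta> (\<beta> (N Y X)) Z p)
    + (ev \<eta> (N Z (\<beta> X)) Y p - ev \<eta> (\<beta> (N Z X)) Y p)"
proof -
  have b: "ev (B_form \<eta> K B) U V = ev \<eta> (\<beta> U) V" for U V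
    by (simp add: ev_def B_form_def ap_def)
  note [simp] = proj_vfields N_vfields V_diff ev_diff_left
  have s: "ev \<eta> (\<beta> U) V p = - ev \<eta> (\<beta> V) U p" if "U \<in> vfields \<A>" "V \<in> vfields \<A>" for U V
    using \<beta>_skew[OF that, of p] ev_sym[of U "\<beta> V"] that by simp
  \<comment> \<open>Subtraction is passed through \<beta> by skewness: move \<beta> to
    \<open>W\<close>, use linearity of \<eta>, and move it back.\<close>
  have br: "ev \<eta> (\<beta> (lie_bracket \<A> U V)) W p = ev \<eta> (\<beta> (N U V)) W p - ev \<eta> (\<beta> (N V U)) W p"
    if "U \<in> vfields \<A>" "V \<in> vfields \<A>" "W \<in> vfields \<A>" for U V W
    using that by (simp add: torsion_free \<beta>_skew)
  \<comment> \<open>The three instances of \<open>s\<close> cancel the terms in which the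
    undifferentiated field stands under \<beta> against the matching Lie bracket terms.\<close>
  show ?thesis
    using X Y Z s[of Y "N X Z"] s[of X "N Y Z"] s[of X "N Z Y"]
    by (simp add: ext_deriv_def b br metric)
qed

end

theorem proposition5p9:
  fixes \<A> :: "('m::{t2_space,second_countable_topology}, 'e::euclidean_space) atlas"
    and \<eta> :: "'m bilin" and K B :: "'m endo"
    and N :: "'m connection"
    and D DB :: "'m vfield \<Rightarrow> 'm vfield \<Rightarrow> 'm vfield"
    and X Y Z :: "'m vfield"
  assumes "smooth_atlas \<A>"
    and "para_kaehler \<A> \<eta> K"
    and "bundle_map \<A> (T_plus \<A> K) (T_minus \<A> K) B"
    and "\<And>X Y. X \<in> sections \<A> (T_plus \<A> K) \<Longrightarrow> Y \<in> sections \<A> (T_plus \<A> K) \<Longrightarrow>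
           ev \<eta> (ap B X) Y = - ev \<eta> X (ap B Y)"
    and "levi_civita \<A> \<eta> N"
    and "is_D_bracket \<A> \<eta> N K D"
    and "is_D_bracket \<A> \<eta> N (B_transform K B) DB"
    and "X \<in> vfields \<A>" and "Y \<in> vfields \<A>" and "Z \<in> vfields \<A>"
  shows "ev \<eta> (DB X Y) Z p = ev \<eta> (D X Y) Z p - ext_deriv \<A> (B_form \<eta> K B) X Y Z p"
proof -
  interpret para_kaehler_B \<A> \<eta> K B N
    using assms by unfold_locales
  note XYZ = assms(8-10)
  have "ev \<eta> (D X Y) Z p = ev \<eta> (canonical_connection K N X Y) Z p
      - ev \<eta> (canonical_connection K N Y X) Z p + ev \<eta> (canonical_connection K N Z X) Y p"
    using assms(6) XYZ by (simp add: is_D_bracket_def ev_diff_left canonical_connection_vfields)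
  moreover have "ev \<eta> (DB X Y) Z p = ev \<eta> (canonical_connection (B_transform K B) N X Y) Z p
      - ev \<eta> (canonical_connection (B_transform K B) N Y X) Z p
      + ev \<eta> (canonical_connection (B_transform K B) N Z X) Y p"
    using assms(7) XYZ by (simp add: is_D_bracket_def ev_diff_left canonical_connection_vfields)
  \<comment> \<open>The three corrections -\<nabla>\<beta> enter with the signs +, -, + of the
    D-bracket, which are the signs of the alternation giving db.\<close>
  ultimately show ?thesis
    using XYZ by (simp add: canonical_connection_B_transform ext_deriv_B_form)
qed

end
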